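(* Let $G$ be an $(n,d,\lambda)$-colored graph with color set $D$. Let $T$ be a tree with edges colored by $D$. For any $U\subset V(G)$ with $|U|=r\cdot\frac{\lambda n}{d}$, the number of disjoint copies of $T$ in $U$ is at least $$\frac{|U|}{\sigma(T)}-\frac{\lambda n}{d},$$ where $\sigma(T)$ is the stringiness of $T$.
   Context: An $(n,d,\lambda)$-graph is a finite undirected $d$-regular graph on $n$ vertices such that all eigenvalues of its adjacency matrix other than the trivial eigenvalue $d$ (one copy, belonging to the constant eigenvector) have absolute value at most $\lambda$. An $(n,d,\lambda)$-colored graph with color set $D$ is a graph whose edges are colored with $|D|$ colors (the elements of $D$) such that for each fixed color the (spanning) subgraph formed by the edges of that color is an $(n,d,\lambda)$-graph. A copy of the edge-colored tree $T$ in $U$ is a (not necessarily induced) subgraph of $G$ with all vertices in $U$ that is isomorphic to $T$ by an isomorphism preserving edge colors. "The number of disjoint copies of $T$ in $U$ is at least $x$" means that there is a family of at least $x$ pairwise vertex-disjoint copies of $T$ in $U$. The stringiness of a graph $T$ with degree sequence $d_1\ge d_2\ge\dots\ge d_k$ (where $k=|V(T)|$) is $\sigma(T)=(d_1+1)\prod_{i=2}^{k}d_i$. Here $r$ is a real number. *)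

theory Defs
  imports "HOL-Analysis.Analysis" "HOL-Computational_Algebra.Computational_Algebra"
    "HOL-Library.Multiset"
begin

text \<open>A simple graph is a finite vertex set with a set of two-element edges. The host graph always
  has the vertex set \<open>UNIV\<close> of a finite type, so that its adjacency matrix is a matrix of the library.\<close>

definition simple_graph :: "'v set \<Rightarrow> 'v set set \<Rightarrow> bool" where
  "simple_graph V E \<longleftrightarrow> finite V \<and> (\<forall>e\<in>E. e \<subseteq> V \<and> card e = 2)"

definition vdegree :: "'v set set \<Rightarrow> 'v \<Rightarrow> nat" where
  "vdegree E v = card {e \<in> E. v \<in> e}"

definition adjacency_matrix :: "'v::finite set set \<Rightarrow> real^'v^'v" where
  "adjacency_matrix E = (\<chi> u v. if {u, v} \<in> E then 1 else 0)"

definition charpoly :: "real^'v^'v \<Rightarrow> real poly" where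
  "charpoly A = det (mat [:0, 1:] - (\<chi> i j. [:A $ i $ j:]))"

text \<open>Eigenvalues with multiplicity. Only real roots are counted; for the symmetric matrices used
  below these are all the roots.\<close>

definition eigenvalues :: "real^'v^'v \<Rightarrow> real multiset" where
  "eigenvalues A = proots (charpoly A)"

text \<open>Multiset difference removes a single copy of the trivial eigenvalue \<open>d\<close>.\<close>

definition ndl_graph :: "nat \<Rightarrow> nat \<Rightarrow> real \<Rightarrow> 'v::finite set set \<Rightarrow> bool" where
  "ndl_graph n d lam E \<longleftrightarrow>
     simple_graph UNIV E \<and> CARD('v) = n \<and> (\<forall>v. vdegree E v = d) \<and>
     (\<forall>\<mu> \<in># eigenvalues (adjacency_matrix E) - {#real d#}. \<bar>\<mu>\<bar> \<le> lam)"

text \<open>Colourings are functions on sets of vertices; only their values on edges matter.\<close>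

definition ndl_colored_graph ::
  "nat \<Rightarrow> nat \<Rightarrow> real \<Rightarrow> 'c set \<Rightarrow> 'v::finite set set \<Rightarrow> ('v set \<Rightarrow> 'c) \<Rightarrow> bool" where
  "ndl_colored_graph n d lam D E col \<longleftrightarrow>
     simple_graph UNIV E \<and> CARD('v) = n \<and> (\<forall>e\<in>E. col e \<in> D) \<and>
     (\<forall>c\<in>D. ndl_graph n d lam {e \<in> E. col e = c})"

definition connected_graph :: "'v set \<Rightarrow> 'v set set \<Rightarrow> bool" where
  "connected_graph V E \<longleftrightarrow> V \<noteq> {} \<and> (\<forall>u\<in>V. \<forall>v\<in>V. (u, v) \<in> {(x, y). {x, y} \<in> E}\<^sup>*)"

definition is_cycle :: "'v set set \<Rightarrow> 'v list \<Rightarrow> bool" where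
  "is_cycle E xs \<longleftrightarrow> 3 \<le> length xs \<and> distinct xs \<and>
     (\<forall>i<length xs. {xs ! i, xs ! (Suc i mod length xs)} \<in> E)"

definition is_tree :: "'v set \<Rightarrow> 'v set set \<Rightarrow> bool" where
  "is_tree V E \<longleftrightarrow> simple_graph V E \<and> connected_graph V E \<and> (\<nexists>xs. is_cycle E xs)"

definition degree_sequence :: "'v set \<Rightarrow> 'v set set \<Rightarrow> nat list" where
  "degree_sequence V E = rev (sorted_list_of_multiset (image_mset (vdegree E) (mset_set V)))"

definition stringiness :: "'v set \<Rightarrow> 'v set set \<Rightarrow> nat" where
  "stringiness V E = (let ds = degree_sequence V E in (hd ds + 1) * prod_list (tl ds))"

text \<open>A copy of the coloured graph \<open>(VT, ET, colT)\<close> is a subgraph \<open>(W, F)\<close> of the coloured graph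
  with edges \<open>E\<close> and colours \<open>col\<close>.\<close>

definition is_copy ::
  "'t set \<Rightarrow> 't set set \<Rightarrow> ('t set \<Rightarrow> 'c) \<Rightarrow> 'v set set \<Rightarrow> ('v set \<Rightarrow> 'c) \<Rightarrow> 'v set \<Rightarrow>
   'v set \<times> 'v set set \<Rightarrow> bool" where
  "is_copy VT ET colT E col U = (\<lambda>(W, F). W \<subseteq> U \<and> F \<subseteq> E \<and>
     (\<exists>\<phi>. bij_betw \<phi> VT W \<and> F = (\<lambda>e. \<phi> ` e) ` ET \<and> (\<forall>e\<in>ET. col (\<phi> ` e) = colT e)))"

definition disjoint_copies ::
  "'t set \<Rightarrow> 't set set \<Rightarrow> ('t set \<Rightarrow> 'c) \<Rightarrow> 'v set set \<Rightarrow> ('v set \<Rightarrow> 'c) \<Rightarrow> 'v set \<Rightarrow>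
   ('v set \<times> 'v set set) set \<Rightarrow> bool" where
  "disjoint_copies VT ET colT E col U \<C> \<longleftrightarrow> finite \<C> \<and>
     (\<forall>C\<in>\<C>. is_copy VT ET colT E col U C) \<and>
     pairwise (\<lambda>C C'. fst C \<inter> fst C' = {}) \<C>"

end

(* Let L = lam n / d and let s be the number of leaves of a star. By the expander mixing lemma in each
   colour, every set of more than s L vertices contains the star with any prescribed colours, so a
   maximal family of disjoint stars in U has at least (|U| - s L) / (s + 1) members. Cutting off from T
   all s leaves at a penultimate vertex of a longest path from a root of maximal degree divides the
   stringiness by exactly s + 1; embedding the remaining tree into the set of star centres shows by
   induction that |U| > (sigma(T) - 1) L forces a copy of T. Removing copies greedily then gives the
   bound, since T has at most sigma(T) vertices. *)

theory Submission imports Defs begin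

text \<open>The root is chosen once and kept through the induction, although it need not have
  maximal degree in the smaller trees: what divides exactly by s + 1 is the degree product with the
  factor of a fixed vertex raised by 1, and only for the original tree is it identified with the
  stringiness. The threshold solves the resulting recursion: (s + 1) (w - 1) L + s L = ((s + 1) w -
  1) L, so the waste s L of the greedy star family is absorbed exactly. Several colours in one star
  are the delicate case. With q colours, a centre fails by lacking neighbours in one of them, and
  pigeonhole loses a factor q. It is regained because a single colour has at most s - q + 1 leaves,
  so a failing vertex has at most s - q neighbours in that colour, which leaves slack q L in the
  mixing estimate and a bound with q squared. The spectral hypothesis concerns roots of the
  characteristic polynomial with one copy of d removed, whereas mixing needs a bound for a quadratic
  form orthogonal to the constants; maximising a Rayleigh quotient there connects the two.\<close>

no_notation fps_nth (infixl \<open>$\<close> 75)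

section \<open>The spectrum of regular graphs and expander mixing\<close>

lemma poly_det: "poly (det A) x = det (\<chi> i j. poly (A $ i $ j) x)"
  for A :: "'a::comm_ring_1 poly ^ 'n ^ 'n"
  by (simp add: det_def poly_sum poly_prod)

text \<open>Linearity in row \<open>k\<close> splits the determinant into one summand per row
  \<open>j\<close>; for \<open>j \<noteq> k\<close> the matrix has two equal rows. The ring is kept
  general because the application is to a matrix of polynomials.\<close>

lemma det_replace_row_by_sum:
  fixes A :: "'a::comm_ring_1 ^ 'n ^ 'n"
  shows "det (\<chi> i. if i = k then (\<Sum>j\<in>UNIV. A $ j) else A $ i) = det A"
proof -
  have "det (\<chi> i. if i = k then (\<Sum>j\<in>UNIV. A $ j) else A $ i) =
      (\<Sum>j\<in>UNIV. det (\<chi> i. if i = k then A $ j else A $ i))"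
    by (rule det_linear_row_sum) simp
  also have "\<dots> = (\<Sum>j\<in>UNIV. if j = k then det A else 0)"
  proof (rule sum.cong)
    fix j
    show "det (\<chi> i. if i = k then A $ j else A $ i) = (if j = k then det A else 0)"
    proof (cases "j = k")
      case True
      have "(\<chi> i. if i = k then A $ j else A $ i) = A"
        using True by (simp add: vec_eq_iff)
      then show ?thesis using True by simp
    next
      case False
      have "det (\<chi> i. if i = k then A $ j else A $ i) = 0"
        by (rule det_identical_rows[of k j]) (use False in \<open>auto simp: row_def vec_eq_iff\<close>)
      then show ?thesis using False by simp
    qed
  qed simp
  also have "\<dots> = det A" by simp
  finally show ?thesis .
qed

lemma det_eq_0_if_kernel:
  fixes A :: "real ^ 'n ^ 'n" and v :: "real ^ 'n"
  assumes "A *v v = 0" "v \<noteq> 0"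
  shows "det A = 0"
proof (rule ccontr)
  assume "det A \<noteq> 0"
  then obtain B where "B ** A = mat 1"
    using invertible_det_nz invertible_left_inverse by blast
  then have "B *v (A *v v) = v"
    by (simp add: matrix_vector_mul_assoc)
  then show False using assms by simp
qed

lemma kernel_if_det_eq_0:
  fixes A :: "real ^ 'n ^ 'n"
  assumes "det A = 0"
  obtains v where "A *v v = 0" "v \<noteq> 0"
proof -
  have "\<not> (\<exists>B. B ** A = mat 1)"
    using assms invertible_det_nz invertible_left_inverse by blast
  then show thesis
    using that by (auto simp: matrix_left_invertible_ker)
qed

lemma poly_charpoly: "poly (charpoly A) x = det (mat x - A)"
proof -
  have "(\<chi> i j. poly ((mat [:0, 1:] - (\<chi> i j. [:A $ i $ j:])) $ i $ j) x) = mat x - A"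
    by (simp add: vec_eq_iff mat_def)
  then show ?thesis
    by (simp add: charpoly_def poly_det)
qed

text \<open>A zero at \<open>\<bar>K\<bar> + 1\<close> would give a vector stretched by more than
  the operator bound \<open>K\<close>. The fact is needed because the roots of a product are the
  union of the roots of the factors, with multiplicity, only when the product is nonzero.\<close>

lemma charpoly_nonzero: "charpoly A \<noteq> 0"
proof
  assume "charpoly A = 0"
  obtain K where K: "\<And>x. norm (A *v x) \<le> norm x * K"
    using bounded_linear.bounded[OF matrix_vector_mul_bounded_linear[of A]] by blast
  have "det (mat (\<bar>K\<bar> + 1) - A) = 0"
    using \<open>charpoly A = 0\<close> by (simp flip: poly_charpoly)
  then obtain v where v: "(mat (\<bar>K\<bar> + 1) - A) *v v = 0" "v \<noteq> 0"
    by (rule kernel_if_det_eq_0)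
  have "mat (\<bar>K\<bar> + 1) *v v = (\<bar>K\<bar> + 1) *\<^sub>R v"
    by (simp add: vec_eq_iff matrix_vector_mult_def mat_def if_distrib if_distribR cong: if_cong)
  then have "A *v v = (\<bar>K\<bar> + 1) *\<^sub>R v"
    using v(1) by (simp add: matrix_vector_mult_diff_rdistrib)
  then have "(\<bar>K\<bar> + 1) * norm v \<le> K * norm v"
    using K[of v] by (simp add: mult.commute)
  moreover have "K * norm v < (\<bar>K\<bar> + 1) * norm v"
    using v(2) by (intro mult_strict_right_mono) auto
  ultimately show False by simp
qed

text \<open>The factor \<open>[:- d, 1:]\<close> of the characteristic polynomial is split off by replacing one row of
  \<open>x I - A\<close> by the sum of all rows, so that no discussion of multiplicities is needed when \<open>\<mu> = d\<close>.\<close>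

lemma eigenvalue_orthogonal_to_ones:
  fixes A :: "real ^ 'n ^ 'n" and v :: "real ^ 'n"
  assumes colsum: "\<And>j. (\<Sum>i\<in>UNIV. A $ i $ j) = d"
    and eig: "A *v v = \<mu> *\<^sub>R v" and "v \<noteq> 0" and orth: "(\<Sum>i\<in>UNIV. v $ i) = 0"
  shows "\<mu> \<in># eigenvalues A - {#d#}"
proof -
  fix k :: 'n
  define P :: "real poly ^ 'n ^ 'n" where "P = mat [:0, 1:] - (\<chi> i j. [:A $ i $ j:])"
  define Q :: "real poly ^ 'n ^ 'n" where "Q = (\<chi> i. if i = k then (\<chi> j. 1) else P $ i)"
  have Pij: "P $ i $ j = (if i = j then [:0, 1:] else 0) - [:A $ i $ j:]" for i j
    by (simp add: P_def mat_def)
  have const: "(\<Sum>i\<in>UNIV. [:A $ i $ j:]) = [:d:]" for j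
    using colsum[of j] by (intro poly_eqI) (auto simp: coeff_sum coeff_pCons split: nat.splits)
  have sumP: "(\<Sum>i\<in>UNIV. P $ i) = [:-d, 1:] *s (\<chi> j. 1)"
    by (simp add: vec_eq_iff Pij sum_subtractf const)
  have "charpoly A = det (\<chi> i. if i = k then (\<Sum>j\<in>UNIV. P $ j) else P $ i)"
    unfolding det_replace_row_by_sum by (simp add: charpoly_def P_def)
  also have "\<dots> = [:-d, 1:] * det Q"
    unfolding sumP Q_def by (rule det_row_mul)
  finally have fact: "charpoly A = [:-d, 1:] * det Q" .
  with charpoly_nonzero[of A] have "det Q \<noteq> 0" by auto
  \<comment> \<open>Row \<open>k\<close> sends \<open>v\<close> to the sum of its entries, which is
    0 by orthogonality; the other rows are those of \<open>\<mu> I - A\<close>.\<close>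
  have "(\<chi> i j. poly (Q $ i $ j) \<mu>) *v v = 0"
  proof -
    have "(\<Sum>j\<in>UNIV. poly (Q $ i $ j) \<mu> * v $ j) = 0" for i
    proof (cases "i = k")
      case True
      then show ?thesis using orth by (simp add: Q_def)
    next
      case False
      have "(\<Sum>j\<in>UNIV. poly (Q $ i $ j) \<mu> * v $ j) =
          (\<Sum>j\<in>UNIV. (if i = j then \<mu> * v $ j else 0) - A $ i $ j * v $ j)"
        using False by (intro sum.cong) (auto simp: Q_def Pij algebra_simps)
      also have "\<dots> = \<mu> * v $ i - (A *v v) $ i"
        by (simp add: sum_subtractf matrix_vector_mult_def)
      finally show ?thesis using eig by simp
    qed
    then show ?thesis by (simp add: vec_eq_iff matrix_vector_mult_def)
  qed
  then have "poly (det Q) \<mu> = 0"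
    unfolding poly_det using \<open>v \<noteq> 0\<close> by (rule det_eq_0_if_kernel)
  moreover have "eigenvalues A - {#d#} = proots (det Q)"
    using \<open>det Q \<noteq> 0\<close> unfolding eigenvalues_def fact by (subst proots_mult) auto
  ultimately show ?thesis
    using \<open>det Q \<noteq> 0\<close> by simp
qed

text \<open>A maximiser of the quadratic form on the unit sphere of \<open>S\<close> is an
  eigenvector, by a first variation argument. Invariance of \<open>S\<close> puts the residual
  \<open>f v - \<mu> v\<close> into \<open>S\<close>, so it is an admissible direction of
  variation.\<close>

lemma rayleigh_maximum:
  fixes f :: "'a::euclidean_space \<Rightarrow> 'a"
  assumes lin: "linear f"
    and sym: "\<And>x y. x \<bullet> f y = f x \<bullet> y"
    and S: "subspace S" "\<And>x. x \<in> S \<Longrightarrow> f x \<in> S" and "z \<in> S" "z \<noteq> 0"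
  obtains v \<mu> where "v \<in> S" "v \<noteq> 0" "f v = \<mu> *\<^sub>R v"
    "\<And>x. x \<in> S \<Longrightarrow> x \<bullet> f x \<le> \<mu> * (x \<bullet> x)"
proof -
  let ?q = "\<lambda>x. x \<bullet> f x"
  have "compact (S \<inter> sphere 0 1)"
    using closed_subspace[OF S(1)] by (intro closed_Int_compact) auto
  moreover have "(1 / norm z) *\<^sub>R z \<in> S \<inter> sphere 0 1"
    using \<open>z \<in> S\<close> \<open>z \<noteq> 0\<close> S(1) by (auto simp: subspace_scale)
  moreover have "continuous_on (S \<inter> sphere 0 1) ?q"
    by (intro continuous_intros linear_continuous_on linear_conv_bounded_linear[THEN iffD1, OF lin])
  ultimately obtain v where v: "v \<in> S" "norm v = 1"
    and max: "\<And>x. x \<in> S \<Longrightarrow> norm x = 1 \<Longrightarrow> ?q x \<le> ?q v"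
    using continuous_attains_sup[of "S \<inter> sphere 0 1" ?q] by fastforce
  have "v \<bullet> v = 1" using v(2) by (simp add: dot_square_norm)
  define \<mu> where "\<mu> = ?q v"
  have bound: "?q x \<le> \<mu> * (x \<bullet> x)" if "x \<in> S" for x
  proof (cases "x = 0")
    case False
    have "?q ((1 / norm x) *\<^sub>R x) \<le> \<mu>"
      unfolding \<mu>_def using False that S(1) by (intro max) (auto simp: subspace_scale)
    moreover have "?q ((1 / norm x) *\<^sub>R x) = ?q x / (x \<bullet> x)"
      by (simp add: linear_scale[OF lin] power2_eq_square flip: power2_norm_eq_inner)
    ultimately have "?q x / (x \<bullet> x) \<le> \<mu>" by simp
    then show ?thesis
      using False by (simp add: pos_divide_le_eq)
  qed simp
  define w where "w = f v - \<mu> *\<^sub>R v"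
  have "w \<in> S"
    unfolding w_def using v S by (intro subspace_diff subspace_scale) auto
  \<comment> \<open>The bound is tested at \<open>v + t w\<close>. Since \<open>\<mu>\<close> is the
    value at \<open>v\<close>, the constant terms cancel and the linear coefficient is twice the
    squared norm of the residual.\<close>
  have ineq: "2 * t * (w \<bullet> w) + t\<^sup>2 * (?q w - \<mu> * (w \<bullet> w)) \<le> 0" for t
  proof -
    have max: "?q (v + t *\<^sub>R w) \<le> \<mu> * ((v + t *\<^sub>R w) \<bullet> (v + t *\<^sub>R w))"
      using v \<open>w \<in> S\<close> S(1) by (intro bound subspace_add subspace_scale)
    have val: "?q (v + t *\<^sub>R w) = \<mu> + 2 * t * (w \<bullet> f v) + t\<^sup>2 * ?q w"
      using sym[of v w]
      by (simp add: \<mu>_def linear_add[OF lin] linear_scale[OF lin] inner_add_left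
          inner_add_right inner_commute power2_eq_square algebra_simps)
    have sq: "(v + t *\<^sub>R w) \<bullet> (v + t *\<^sub>R w) = 1 + 2 * t * (w \<bullet> v) + t\<^sup>2 * (w \<bullet> w)"
      using \<open>v \<bullet> v = 1\<close> by (simp add: inner_add_left inner_add_right inner_commute
          power2_eq_square algebra_simps)
    have "w \<bullet> w = w \<bullet> f v - \<mu> * (w \<bullet> v)"
      by (simp add: w_def inner_diff_right)
    then have "2 * t * (w \<bullet> w) = 2 * t * (w \<bullet> f v) - \<mu> * (2 * t * (w \<bullet> v))"
      by algebra
    moreover have "\<mu> * (1 + 2 * t * (w \<bullet> v) + t\<^sup>2 * (w \<bullet> w)) =
        \<mu> + \<mu> * (2 * t * (w \<bullet> v)) + t\<^sup>2 * (\<mu> * (w \<bullet> w))"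
      by (simp add: algebra_simps)
    moreover have "t\<^sup>2 * (?q w - \<mu> * (w \<bullet> w)) = t\<^sup>2 * ?q w - t\<^sup>2 * (\<mu> * (w \<bullet> w))"
      by (rule right_diff_distrib)
    \<comment> \<open>Replacing the nonlinear terms by real variables turns the conclusion into
      linear arithmetic.\<close>
    moreover have "a + b \<le> 0" if "m + p + q \<le> c" "a = p - y" "c = m + y + z" "b = q - z"
      for a b c m p q y z :: real using that by linarith
    ultimately show ?thesis using max unfolding val sq by blast
  qed
  have "w \<bullet> w = 0"
  proof (rule ccontr)
    assume "w \<bullet> w \<noteq> 0"
    then have pos: "w \<bullet> w > 0" by simp
    \<comment> \<open>The quadratic coefficient is at least \<open>- c\<close>, so at
      \<open>t = (w \<bullet> w) / c\<close> the quadratic term cancels at most half of the positive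
      linear term.\<close>
    define c where "c = \<bar>?q w - \<mu> * (w \<bullet> w)\<bar> + 1"
    have "c > 0" "?q w - \<mu> * (w \<bullet> w) \<ge> - c" by (auto simp: c_def)
    define t where "t = (w \<bullet> w) / c"
    have "t > 0" using pos \<open>c > 0\<close> by (simp add: t_def)
    have "t\<^sup>2 * (- c) \<le> t\<^sup>2 * (?q w - \<mu> * (w \<bullet> w))"
      using \<open>?q w - \<mu> * (w \<bullet> w) \<ge> - c\<close> by (intro mult_left_mono) auto
    moreover have "t\<^sup>2 * (- c) = - (t * (w \<bullet> w))"
      using \<open>c > 0\<close> by (simp add: t_def power2_eq_square)
    moreover have "t * (w \<bullet> w) > 0" using \<open>t > 0\<close> pos by simp
    ultimately show False using ineq[of t] by simp
  qed
  then have "f v = \<mu> *\<^sub>R v" by (simp add: w_def)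
  moreover have "v \<noteq> 0" using v(2) by auto
  ultimately show thesis using that v(1) bound by blast
qed

section \<open>Adjacency matrices and edge counts\<close>

lemma vdegree_eq_card_neighbours:
  assumes "simple_graph V E"
  shows "vdegree E u = card {v. {u, v} \<in> E}"
proof -
  have "bij_betw (\<lambda>v. {u, v}) {v. {u, v} \<in> E} {e \<in> E. u \<in> e}"
    unfolding bij_betw_def
  proof
    show "inj_on (\<lambda>v. {u, v}) {v. {u, v} \<in> E}"
      by (auto simp: inj_on_def doubleton_eq_iff)
    show "(\<lambda>v. {u, v}) ` {v. {u, v} \<in> E} = {e \<in> E. u \<in> e}"
    proof (intro equalityI subsetI)
      fix e assume "e \<in> {e \<in> E. u \<in> e}"
      then have e: "e \<in> E" "u \<in> e" by auto
      then have "card e = 2" using assms by (auto simp: simple_graph_def)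
      then obtain v where "e = {u, v}" using e(2) by (auto simp: card_2_iff)
      then show "e \<in> (\<lambda>v. {u, v}) ` {v. {u, v} \<in> E}" using e(1) by auto
    qed auto
  qed
  then show ?thesis
    by (simp add: vdegree_def bij_betw_same_card)
qed

lemma simple_graph_no_loop: "simple_graph V E \<Longrightarrow> {u, v} \<in> E \<Longrightarrow> u \<noteq> v"
  by (fastforce simp: simple_graph_def)

lemma transpose_adjacency_matrix: "transpose (adjacency_matrix E) = adjacency_matrix E"
  by (simp add: vec_eq_iff transpose_def adjacency_matrix_def insert_commute)

lemma adjacency_matrix_self_adjoint:
  "x \<bullet> (adjacency_matrix E *v y) = (adjacency_matrix E *v x) \<bullet> y"
  by (metis dot_lmul_matrix transpose_adjacency_matrix transpose_matrix_vector)

lemma adjacency_matrix_row_sum: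
  "(\<Sum>v\<in>S. adjacency_matrix E $ u $ v) = real (card {v \<in> S. {u, v} \<in> E})"
  by (simp add: adjacency_matrix_def flip: sum.inter_filter)

lemma ndl_graph_simple: "ndl_graph n d lam E \<Longrightarrow> simple_graph UNIV E"
  by (simp add: ndl_graph_def)

lemma adjacency_matrix_ones:
  assumes "ndl_graph n d lam E"
  shows "adjacency_matrix E *v (\<chi> i. 1) = real d *\<^sub>R (\<chi> i. 1)"
proof -
  have "(\<Sum>v\<in>UNIV. adjacency_matrix E $ u $ v) = real d" for u
    using assms vdegree_eq_card_neighbours[OF ndl_graph_simple[OF assms]]
    unfolding adjacency_matrix_row_sum by (simp add: ndl_graph_def)
  then show ?thesis
    by (simp add: vec_eq_iff matrix_vector_mult_def)
qed

text \<open>The hyperplane orthogonal to the constants is invariant because the matrix is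
  self-adjoint and the constants are an eigenvector. Extremal values of the form there are
  eigenvalues counted after one copy of \<open>d\<close> is removed.\<close>

lemma ndl_graph_quadratic_bound:
  fixes E :: "'v::finite set set" and x :: "real ^ 'v"
  assumes ndl: "ndl_graph n d lam E" and x: "(\<chi> i. 1) \<bullet> x = 0"
  shows "\<bar>x \<bullet> (adjacency_matrix E *v x)\<bar> \<le> lam * (x \<bullet> x)"
proof (cases "x = 0")
  case False
  define A where "A = adjacency_matrix E"
  define S :: "(real ^ 'v) set" where "S = {x. (\<chi> i. 1) \<bullet> x = 0}"
  have sub: "subspace S" unfolding S_def by (rule subspace_hyperplane)
  have inv: "A *v y \<in> S" if "y \<in> S" for y
    using that unfolding S_def A_def
    by (simp add: adjacency_matrix_self_adjoint adjacency_matrix_ones[OF ndl])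
  have colsum: "(\<Sum>i\<in>UNIV. A $ i $ j) = real d" for j
  proof -
    have "(\<Sum>i\<in>UNIV. A $ i $ j) = (\<Sum>i\<in>UNIV. adjacency_matrix E $ j $ i)"
      by (simp add: A_def adjacency_matrix_def insert_commute)
    also have "\<dots> = (adjacency_matrix E *v (\<chi> i. 1)) $ j"
      by (simp add: matrix_vector_mult_def)
    finally show ?thesis by (simp add: adjacency_matrix_ones[OF ndl])
  qed
  have eig: "\<bar>\<mu>\<bar> \<le> lam" if "A *v v = \<mu> *\<^sub>R v" "v \<noteq> 0" "v \<in> S" for \<mu> v
  proof -
    have "(\<Sum>i\<in>UNIV. v $ i) = 0" using that(3) by (simp add: S_def inner_vec_def)
    then have "\<mu> \<in># eigenvalues A - {#real d#}"
      by (rule eigenvalue_orthogonal_to_ones[OF colsum that(1,2)])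
    then show ?thesis using ndl by (auto simp: ndl_graph_def A_def)
  qed
  have "x \<in> S" using x by (simp add: S_def)
  \<comment> \<open>The signs \<open>c = 1\<close> and \<open>c = -1\<close> give the upper and the
    lower estimate: an eigenvalue \<open>\<mu>\<close> of \<open>c A\<close> is an eigenvalue
    \<open>c \<mu>\<close> of \<open>A\<close>, with the same absolute value.\<close>
  have bound: "c * (x \<bullet> (A *v x)) \<le> lam * (x \<bullet> x)" if "\<bar>c\<bar> = 1" for c
  proof -
    have lin: "linear (\<lambda>x. c *\<^sub>R (A *v x))"
      by (intro linear_compose_scale_right matrix_vector_mul_linear)
    obtain v \<mu> where v: "v \<in> S" "v \<noteq> 0" "c *\<^sub>R (A *v v) = \<mu> *\<^sub>R v"
      and max: "\<And>x. x \<in> S \<Longrightarrow> x \<bullet> (c *\<^sub>R (A *v x)) \<le> \<mu> * (x \<bullet> x)"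
      by (rule rayleigh_maximum[OF lin _ sub _ \<open>x \<in> S\<close> False])
        (auto simp: A_def[symmetric] adjacency_matrix_self_adjoint[of _ E, folded A_def] inv
          subspace_scale[OF sub])
    have "c * c = 1" using that by (metis abs_mult_self_eq mult_1)
    then have "A *v v = (c * \<mu>) *\<^sub>R v"
      by (metis v(3) scaleR_one scaleR_scaleR)
    then have "\<mu> \<le> lam" using eig[of v "c * \<mu>"] v that by (simp add: abs_mult)
    then have "\<mu> * (x \<bullet> x) \<le> lam * (x \<bullet> x)" by (intro mult_right_mono) auto
    then show ?thesis using max[OF \<open>x \<in> S\<close>] by simp
  qed
  show ?thesis
    using bound[of 1] bound[of "-1"] by (simp add: A_def abs_le_iff)
qed simp

text \<open>Polarisation of the quadratic bound. The vectors are first rescaled to equal norm, so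
  that the parallelogram law yields exactly the product of the norms.\<close>

lemma ndl_graph_bilinear_bound:
  fixes E :: "'v::finite set set" and x y :: "real ^ 'v"
  assumes ndl: "ndl_graph n d lam E" and x: "(\<chi> i. 1) \<bullet> x = 0" and y: "(\<chi> i. 1) \<bullet> y = 0"
  shows "- (lam * norm x * norm y) \<le> x \<bullet> (adjacency_matrix E *v y)"
proof (cases "x = 0 \<or> y = 0")
  case False
  define A where "A = adjacency_matrix E"
  define a b where "a = norm y *\<^sub>R x" and "b = norm x *\<^sub>R y"
  let ?N = "norm x * norm y"
  have "?N > 0" using False by simp
  have sq: "a \<bullet> a = ?N\<^sup>2" "b \<bullet> b = ?N\<^sup>2"
    by (simp_all add: a_def b_def power_mult_distrib power2_eq_square flip: power2_norm_eq_inner)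
  have "(\<chi> i. 1) \<bullet> (a + b) = 0" "(\<chi> i. 1) \<bullet> (a - b) = 0"
    using x y by (simp_all add: a_def b_def inner_add_right inner_diff_right)
  then have "- (lam * ((a + b) \<bullet> (a + b))) \<le> (a + b) \<bullet> (A *v (a + b))"
    "(a - b) \<bullet> (A *v (a - b)) \<le> lam * ((a - b) \<bullet> (a - b))"
    using ndl_graph_quadratic_bound[OF ndl] unfolding A_def by (simp_all add: abs_le_iff minus_le_iff)
  moreover have "(a + b) \<bullet> (A *v (a + b)) - (a - b) \<bullet> (A *v (a - b)) = 4 * (a \<bullet> (A *v b))"
    using adjacency_matrix_self_adjoint[of b E a]
    by (simp add: A_def matrix_vector_right_distrib matrix_vector_mult_diff_distrib inner_add_left
        inner_add_right inner_diff_left inner_diff_right inner_commute)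
  moreover have "(a + b) \<bullet> (a + b) + (a - b) \<bullet> (a - b) = 4 * ?N\<^sup>2"
    using sq by (simp add: inner_add_left inner_add_right inner_diff_left inner_diff_right)
  then have "lam * ((a + b) \<bullet> (a + b)) + lam * ((a - b) \<bullet> (a - b)) = 4 * (lam * ?N\<^sup>2)"
    by (simp flip: distrib_left)
  ultimately have "- (lam * ?N\<^sup>2) \<le> a \<bullet> (A *v b)" by simp
  moreover have "a \<bullet> (A *v b) = ?N * (x \<bullet> (A *v y))"
    by (simp add: a_def b_def matrix_vector_mult_scaleR)
  ultimately have "?N * (- (lam * ?N)) \<le> ?N * (x \<bullet> (A *v y))"
    by (simp add: power2_eq_square algebra_simps)
  then show ?thesis
    unfolding mult_le_cancel_left_pos[OF \<open>?N > 0\<close>] by (simp add: A_def mult.assoc)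
qed auto

text \<open>Each indicator vector is a multiple of the all-ones vector plus a centred part. The
  constant parts give the main term, the mixed terms vanish, and the centred parts give the error,
  since centring does not increase the norm. The count is over ordered pairs, so \<open>B\<close>
  and \<open>U\<close> may overlap.\<close>

lemma expander_mixing_lower:
  fixes E :: "'v::finite set set" and B U :: "'v set"
  assumes ndl: "ndl_graph n d lam E" and "0 \<le> lam"
  shows "real d * real (card B) * real (card U) / real n - lam * sqrt (real (card B) * real (card U))
    \<le> (\<Sum>u\<in>B. real (card {v \<in> U. {u, v} \<in> E}))"
proof -
  define A where "A = adjacency_matrix E"
  define one :: "real ^ 'v" where "one = (\<chi> i. 1)"
  define ind :: "'v set \<Rightarrow> real ^ 'v" where "ind X = (\<chi> i. if i \<in> X then 1 else 0)" for X
  define cen :: "'v set \<Rightarrow> real ^ 'v" where "cen X = ind X - (card X / n) *\<^sub>R one" for X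
  have n: "CARD('v) = n" "n > 0"
    using ndl zero_less_card_finite[where 'a='v] by (auto simp: ndl_graph_def)
  have one: "one \<bullet> one = n" "one \<bullet> ind X = card X" for X
    using n by (simp_all add: one_def ind_def inner_vec_def sum.If_cases)
  have cen: "one \<bullet> cen X = 0" for X
    using n by (simp add: cen_def inner_diff_right one)
  have Aone: "A *v one = real d *\<^sub>R one"
    unfolding A_def one_def by (rule adjacency_matrix_ones[OF ndl])
  have norm: "norm (cen X) \<le> sqrt (card X)" for X
  proof -
    have "ind X \<bullet> ind X = card X"
      by (simp add: ind_def inner_vec_def sum.If_cases if_distrib cong: if_cong)
    moreover have "cen X \<bullet> cen X = cen X \<bullet> ind X"
      using cen[of X] by (subst (2) cen_def) (simp add: inner_diff_right inner_commute)
    moreover have "cen X \<bullet> ind X = ind X \<bullet> ind X - card X / n * card X"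
      by (simp add: cen_def inner_diff_left one)
    ultimately have "cen X \<bullet> cen X \<le> card X" by simp
    then show ?thesis by (simp add: norm_eq_sqrt_inner)
  qed
  have "ind B \<bullet> (A *v ind U) = (\<Sum>u\<in>UNIV. if u \<in> B then (A *v ind U) $ u else 0)"
    unfolding inner_vec_def by (intro sum.cong) (auto simp: ind_def)
  also have "\<dots> = (\<Sum>u\<in>B. (A *v ind U) $ u)" by (simp add: sum.If_cases)
  also have "\<dots> = (\<Sum>u\<in>B. real (card {v \<in> U. {u, v} \<in> E}))"
    unfolding A_def adjacency_matrix_row_sum[symmetric]
    by (simp add: matrix_vector_mult_def ind_def if_distrib sum.If_cases cong: if_cong)
  finally have edges: "ind B \<bullet> (A *v ind U) = (\<Sum>u\<in>B. real (card {v \<in> U. {u, v} \<in> E}))" .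
  have ind: "ind X = cen X + (card X / n) *\<^sub>R one" for X by (simp add: cen_def)
  have "one \<bullet> (A *v cen U) = 0"
    using Aone cen[of U] unfolding A_def adjacency_matrix_self_adjoint by simp
  then have "ind B \<bullet> (A *v ind U) = cen B \<bullet> (A *v cen U) + d * card B * card U / n"
    unfolding ind using n cen[of B]
    by (simp add: matrix_vector_right_distrib matrix_vector_mult_scaleR Aone inner_add_left
        inner_add_right one inner_commute[of "cen B" one])
  moreover have "- (lam * norm (cen B) * norm (cen U)) \<le> cen B \<bullet> (A *v cen U)"
    unfolding A_def by (rule ndl_graph_bilinear_bound[OF ndl]) (use cen in \<open>auto simp: one_def\<close>)
  moreover have "lam * norm (cen B) * norm (cen U) \<le> lam * sqrt (card B * card U)"
    using norm[of B] norm[of U] \<open>0 \<le> lam\<close> unfolding of_nat_mult real_sqrt_mult mult.assoc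
    by (intro mult_left_mono mult_mono) auto
  ultimately show ?thesis unfolding edges of_nat_mult by linarith
qed

text \<open>The test vector is \<open>e\<^sub>u - e\<^sub>v\<close> for an edge \<open>{u, v}\<close>.\<close>

lemma ndl_graph_lam_ge_1:
  fixes E :: "'v::finite set set"
  assumes ndl: "ndl_graph n d lam E" and "0 < d"
  shows "1 \<le> lam"
proof -
  fix u :: 'v
  have "vdegree E u = d" using ndl by (simp add: ndl_graph_def)
  then have "card {v. {u, v} \<in> E} > 0"
    using vdegree_eq_card_neighbours[OF ndl_graph_simple[OF ndl]] \<open>0 < d\<close> by metis
  then have "{v. {u, v} \<in> E} \<noteq> {}" unfolding card_gt_0_iff by simp
  then obtain v where uv: "{u, v} \<in> E" by auto
  have "u \<noteq> v" using simple_graph_no_loop[OF ndl_graph_simple[OF ndl] uv] .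
  have loop: "{w} \<notin> E" for w
    using simple_graph_no_loop[OF ndl_graph_simple[OF ndl], of w w] by auto
  define x where "x = axis u (1::real) - axis v 1"
  have "(\<chi> i. 1) \<bullet> x = 0" by (simp add: x_def inner_diff_right inner_axis)
  then have "\<bar>x \<bullet> (adjacency_matrix E *v x)\<bar> \<le> lam * (x \<bullet> x)"
    by (rule ndl_graph_quadratic_bound[OF ndl])
  moreover have "x \<bullet> x = 2"
    using \<open>u \<noteq> v\<close> by (simp add: x_def inner_diff_left inner_diff_right inner_axis_axis)
  moreover have "x \<bullet> (adjacency_matrix E *v x) = - 2"
    using uv loop insert_commute[of v u "{}"]
    by (simp add: x_def matrix_vector_mult_diff_distrib inner_diff_left inner_diff_right
        inner_axis' matrix_vector_mult_basis column_def adjacency_matrix_def)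
  ultimately show ?thesis by simp
qed

section \<open>Coloured stars\<close>

text \<open>Members of size \<open>k\<close> are removed until at most \<open>b\<close> elements are
  left. This serves twice, for stars and for copies of the tree.\<close>

lemma disjoint_family_greedy:
  fixes b :: real
  assumes "finite U" and card: "\<And>A. A \<in> F \<Longrightarrow> card A = k" and "0 < k"
    and ex: "\<And>W. W \<subseteq> U \<Longrightarrow> b < real (card W) \<Longrightarrow> \<exists>A\<in>F. A \<subseteq> W"
  shows "\<exists>\<C>\<subseteq>F. finite \<C> \<and> (\<forall>A\<in>\<C>. A \<subseteq> U) \<and> pairwise disjnt \<C> \<and>
    real (card U) - b \<le> real k * real (card \<C>)"
  using assms(1) ex
proof (induction U rule: finite_psubset_induct)
  case (psubset U)
  show ?case
  proof (cases "b < real (card U)")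
    case False
    then show ?thesis by (intro exI[of _ "{}"]) auto
  next
    case True
    then obtain A where A: "A \<in> F" "A \<subseteq> U" using psubset.prems by blast
    have "card A = k" "A \<noteq> {}" using card[OF A(1)] \<open>0 < k\<close> by auto
    have "U - A \<subset> U" using A(2) \<open>A \<noteq> {}\<close> by blast
    then obtain \<C> where C: "\<C> \<subseteq> F" "finite \<C>" "\<forall>B\<in>\<C>. B \<subseteq> U - A" "pairwise disjnt \<C>"
      "real (card (U - A)) - b \<le> real k * real (card \<C>)"
      using psubset.IH[OF \<open>U - A \<subset> U\<close>] psubset.prems[OF subset_trans[OF _ Diff_subset]] by metis
    have "A \<notin> \<C>" using C(3) \<open>A \<noteq> {}\<close> by blast
    have "card U = card (U - A) + k"
      using A(2) \<open>card A = k\<close> psubset.hyps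
      by (metis card_Diff_subset card_mono finite_subset le_add_diff_inverse2)
    then have "real (card U) - b \<le> real k * real (card (insert A \<C>))"
      using C(2,5) \<open>A \<notin> \<C>\<close> by (simp add: distrib_left)
    moreover have "pairwise disjnt (insert A \<C>)"
      using C(3,4) by (auto simp: pairwise_insert disjnt_def)
    ultimately show ?thesis
      using A C(1-3) by (intro exI[of _ "insert A \<C>"]) auto
  qed
qed

text \<open>As the sets \<open>N c\<close> are disjoint, no Hall argument is needed: each fibre of
  \<open>k\<close> is injected into its own \<open>N c\<close>. It selects the leaves of a star
  colour by colour, the neighbourhoods of a vertex in different colours being disjoint.\<close>

lemma inj_on_selection:
  assumes "finite S" and fin: "\<And>c. c \<in> k ` S \<Longrightarrow> finite (N c)"
    and le: "\<And>c. c \<in> k ` S \<Longrightarrow> card {x \<in> S. k x = c} \<le> card (N c)"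
    and disj: "\<And>c c'. c \<noteq> c' \<Longrightarrow> N c \<inter> N c' = {}"
  shows "\<exists>f. inj_on f S \<and> (\<forall>x\<in>S. f x \<in> N (k x))"
proof -
  have "\<forall>c\<in>k ` S. \<exists>g. g ` {x \<in> S. k x = c} \<subseteq> N c \<and> inj_on g {x \<in> S. k x = c}"
    by (intro ballI card_le_inj) (use assms(1) fin le in auto)
  then obtain g where g: "\<And>c. c \<in> k ` S \<Longrightarrow> g c ` {x \<in> S. k x = c} \<subseteq> N c"
    "\<And>c. c \<in> k ` S \<Longrightarrow> inj_on (g c) {x \<in> S. k x = c}"
    by metis
  have mem: "g (k x) x \<in> N (k x)" if "x \<in> S" for x
    using g(1)[of "k x"] that by blast
  moreover have "inj_on (\<lambda>x. g (k x) x) S"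
  proof (rule inj_onI)
    fix x y assume xy: "x \<in> S" "y \<in> S" "g (k x) x = g (k y) y"
    then have "k x = k y" using mem disj by (metis disjoint_iff)
    then show "x = y" using g(2)[of "k x"] xy by (auto simp: inj_on_def)
  qed
  ultimately show ?thesis by blast
qed

text \<open>The leaves are indexed by a set \<open>S\<close> of tree vertices, so that a star in the
  host directly says where the leaves cut off from the tree are to be placed.\<close>

definition star_in :: "'v set set \<Rightarrow> ('v set \<Rightarrow> 'c) \<Rightarrow> 't set \<Rightarrow> ('t \<Rightarrow> 'c) \<Rightarrow> 'v set \<Rightarrow> 'v \<Rightarrow>
    ('t \<Rightarrow> 'v) \<Rightarrow> bool" where
  "star_in E col S k U u f \<longleftrightarrow> u \<in> U \<and> inj_on f S \<and> f ` S \<subseteq> U \<and> u \<notin> f ` S \<and>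
     (\<forall>x\<in>S. {u, f x} \<in> E \<and> col {u, f x} = k x)"

text \<open>The pairs between \<open>B\<close> and \<open>U\<close> number at most \<open>m\<close>
  times \<open>card B\<close>, while the main term of the mixing bound exceeds
  \<open>(m + q) * lam\<close> times \<open>card B\<close>. The error term must therefore account
  for the surplus \<open>q\<close>; squaring gives the claim.\<close>

lemma few_vertices_of_small_degree:
  fixes E :: "'v::finite set set" and B U :: "'v set" and q :: real
  assumes ndl: "ndl_graph n d lam E" and "0 < d"
    and deg: "\<And>u. u \<in> B \<Longrightarrow> card {v \<in> U. {u, v} \<in> E} \<le> m"
    and "0 \<le> q" and U: "(real m + q) * (lam * real n / real d) < real (card U)" and "B \<noteq> {}"
  shows "q\<^sup>2 * real (card B) < real (card U)"
proof -
  define a b where "a = real (card U)" and "b = real (card B)"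
  have "1 \<le> lam" by (rule ndl_graph_lam_ge_1[OF ndl \<open>0 < d\<close>])
  have "n > 0" using ndl zero_less_card_finite[where 'a='v] by (auto simp: ndl_graph_def)
  have "b > 0" using \<open>B \<noteq> {}\<close> by (simp add: b_def card_gt_0_iff)
  have "(\<Sum>u\<in>B. real (card {v \<in> U. {u, v} \<in> E})) \<le> (\<Sum>u\<in>B. real m)"
    using deg by (intro sum_mono) simp
  \<comment> \<open>The factor 1 is displayed in order to be raised to \<open>lam\<close>, which
    brings the edge count to the scale of the threshold.\<close>
  also have "\<dots> = 1 * (real m * b)" by (simp add: b_def)
  also have "\<dots> \<le> lam * (real m * b)"
    using \<open>1 \<le> lam\<close> \<open>b > 0\<close> by (intro mult_right_mono) auto
  finally have "real d * b * a / real n - lam * sqrt (b * a) \<le> lam * (real m * b)"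
    using expander_mixing_lower[OF ndl, of B U] \<open>1 \<le> lam\<close> by (simp add: a_def b_def)
  moreover have "(real m + q) * b * lam < real d * b * a / real n"
  proof -
    have "(real m + q) * lam < a * real d / real n"
      using U \<open>0 < d\<close> \<open>n > 0\<close> by (simp add: a_def field_simps)
    then have "(real m + q) * lam * b < a * real d / real n * b"
      using \<open>b > 0\<close> by (rule mult_strict_right_mono)
    then show ?thesis by (simp add: mult_ac)
  qed
  ultimately have "lam * (q * b) < lam * sqrt (b * a)"
    by (simp add: algebra_simps)
  then have "q * b < sqrt (b * a)" using \<open>1 \<le> lam\<close> by simp
  then have "(q * b)\<^sup>2 < (sqrt (b * a))\<^sup>2"
    using \<open>0 \<le> q\<close> \<open>b > 0\<close> by (intro power_strict_mono) auto
  also have "\<dots> = b * a" using \<open>b > 0\<close> by (simp add: a_def)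
  finally have "(q * b)\<^sup>2 < b * a" .
  then have "b * (q\<^sup>2 * b) < b * a" by (simp add: power2_eq_square mult_ac)
  then show ?thesis using \<open>b > 0\<close> by (simp add: a_def b_def)
qed

text \<open>If there is no star, every vertex of \<open>U\<close> has too few neighbours in one of the \<open>q\<close> colours used, so one
  of the colours has at least \<open>card U / q\<close> bad vertices; the mixing bound allows fewer than
  \<open>card U / q\<^sup>2\<close>.\<close>

lemma star_exists:
  fixes E :: "'v::finite set set" and U :: "'v set" and k :: "'t \<Rightarrow> 'c"
  assumes G: "ndl_colored_graph n d lam D E col" and "0 < d"
    and S: "finite S" "S \<noteq> {}" "k ` S \<subseteq> D"
    and U: "real (card S) * (lam * real n / real d) < real (card U)"
  shows "\<exists>u f. star_in E col S k U u f"
proof (rule ccontr)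
  assume no: "\<nexists>u f. star_in E col S k U u f"
  define N where "N u c = {v \<in> U. {u, v} \<in> {e \<in> E. col e = c}}" for u c
  define M where "M c = card {x \<in> S. k x = c}" for c
  define q where "q = card (k ` S)"
  define B where "B c = {u \<in> U. card (N u c) < M c}" for c
  have ndl: "ndl_graph n d lam {e \<in> E. col e = c}" if "c \<in> k ` S" for c
    using G S(3) that by (auto simp: ndl_colored_graph_def)
  have "q > 0" using S by (simp add: q_def card_gt_0_iff)
  obtain c0 where "c0 \<in> k ` S" using S(2) by blast
  then have "1 \<le> lam" using ndl_graph_lam_ge_1[OF ndl \<open>0 < d\<close>] by blast
  then have "0 \<le> lam * real n / real d" by simp
  then have "0 < card U" using U by (smt (verit) mult_nonneg_nonneg of_nat_0_le_iff of_nat_0_less_iff)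
  have "\<exists>c\<in>k ` S. u \<in> B c" if "u \<in> U" for u
  proof (rule ccontr)
    assume "\<not> ?thesis"
    then have "M c \<le> card (N u c)" if "c \<in> k ` S" for c
      using that \<open>u \<in> U\<close> by (auto simp: B_def not_less)
    then obtain f where f: "inj_on f S" "\<And>x. x \<in> S \<Longrightarrow> f x \<in> N u (k x)"
      using inj_on_selection[OF S(1), of k "N u"] by (force simp: M_def N_def)
    have "simple_graph UNIV E" using G by (simp add: ndl_colored_graph_def)
    then have "u \<noteq> f x" if "x \<in> S" for x
      using f(2)[OF that] simple_graph_no_loop[of UNIV E "f x" "f x"] by (auto simp: N_def)
    then have "star_in E col S k U u f"
      using f that by (auto simp: star_in_def N_def)
    with no show False by blast
  qed
  then have "U \<subseteq> (\<Union>c\<in>k ` S. B c)" by blast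
  then have "card U \<le> card (\<Union>c\<in>k ` S. B c)" by (intro card_mono) auto
  also have "\<dots> \<le> (\<Sum>c\<in>k ` S. card (B c))" using S(1) by (intro card_UN_le) simp
  finally have "card U \<le> (\<Sum>c\<in>k ` S. card (B c))" .
  then have le: "real (card U) \<le> (\<Sum>c\<in>k ` S. real (card (B c)))"
    by (metis of_nat_le_iff of_nat_sum)
  have lt: "(real q)\<^sup>2 * real (card (B c)) < real (card U)" if c: "c \<in> k ` S" for c
  proof (cases "B c = {}")
    case True
    then show ?thesis using \<open>0 < card U\<close> by simp
  next
    case False
    have "M c > 0" using c S(1) by (auto simp: M_def card_gt_0_iff)
    \<comment> \<open>Each of the other \<open>q - 1\<close> colours occurs on some leaf, so
      \<open>M c + (q - 1) \<le> card S\<close>. A bad vertex has at most \<open>m = M c - 1\<close>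
      neighbours in colour \<open>c\<close>, hence \<open>m + q\<close> does not exceed
      \<open>card S\<close>.\<close>
    have "k ` S - {c} \<subseteq> k ` (S - {x \<in> S. k x = c})" by auto
    then have "card (k ` S - {c}) \<le> card (S - {x \<in> S. k x = c})"
      using S(1) by (meson surj_card_le finite_Diff)
    also have "card (k ` S - {c}) = q - 1" using c S(1) by (simp add: q_def)
    also have "card (S - {x \<in> S. k x = c}) = card S - M c"
      using S(1) by (subst card_Diff_subset) (auto simp: M_def)
    finally have "q - 1 \<le> card S - M c" .
    moreover have "M c \<le> card S" unfolding M_def using S(1) by (intro card_mono) auto
    ultimately have "real (M c - 1) + real q \<le> real (card S)"
      using \<open>M c > 0\<close> \<open>q > 0\<close> by linarith
    then have "(real (M c - 1) + real q) * (lam * real n / real d) < real (card U)"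
      using U \<open>0 \<le> lam * real n / real d\<close> by (meson le_less_trans mult_right_mono)
    moreover have "card {v \<in> U. {u, v} \<in> {e \<in> E. col e = c}} \<le> M c - 1" if "u \<in> B c" for u
      using that by (auto simp: B_def N_def)
    ultimately show ?thesis
      using False by (intro few_vertices_of_small_degree[OF ndl[OF c] \<open>0 < d\<close>]) auto
  qed
  have "(real q)\<^sup>2 * real (card U) \<le> (\<Sum>c\<in>k ` S. (real q)\<^sup>2 * real (card (B c)))"
    unfolding sum_distrib_left[symmetric] by (intro mult_left_mono le) simp
  also have "\<dots> < (\<Sum>c\<in>k ` S. real (card U))"
    using S(1,2) lt by (intro sum_strict_mono) auto
  also have "\<dots> = real q * real (card U)" by (simp add: q_def)
  also have "\<dots> \<le> (real q)\<^sup>2 * real (card U)"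
    using \<open>q > 0\<close> by (intro mult_right_mono) (auto simp: power2_eq_square)
  finally show False by simp
qed

section \<open>Embedding trees\<close>

text \<open>The head of the list is the far end of the path, so that paths starting at \<open>\<rho>\<close> are prolonged by
  \<open>Cons\<close>.\<close>

definition path_from :: "'v set \<Rightarrow> 'v set set \<Rightarrow> 'v \<Rightarrow> 'v list \<Rightarrow> bool" where
  "path_from V E \<rho> xs \<longleftrightarrow> xs \<noteq> [] \<and> last xs = \<rho> \<and> distinct xs \<and> set xs \<subseteq> V \<and>
     (\<forall>i. Suc i < length xs \<longrightarrow> {xs ! i, xs ! Suc i} \<in> E)"

lemma path_from_Cons:
  assumes "path_from V E \<rho> (x # xs)" "y \<in> V" "y \<notin> set (x # xs)" "{y, x} \<in> E"
  shows "path_from V E \<rho> (y # x # xs)"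
  using assms by (auto simp: path_from_def nth_Cons split: nat.splits)

lemma path_from_tl: "path_from V E \<rho> (y # x # xs) \<Longrightarrow> path_from V E \<rho> (x # xs)"
  by (force simp: path_from_def)

lemma path_from_head_edge: "path_from V E \<rho> (y # x # xs) \<Longrightarrow> {y, x} \<in> E"
  by (force simp: path_from_def)

text \<open>An edge from the head to position \<open>j \<ge> 2\<close> would close the first
  \<open>j + 1\<close> vertices to a cycle, and \<open>j = 0\<close> would be a loop.\<close>

lemma path_from_no_chord:
  assumes E: "simple_graph V E" "\<nexists>xs. is_cycle E xs"
    and path: "path_from V E \<rho> xs" and z: "{hd xs, z} \<in> E" "z \<in> set xs"
  shows "1 < length xs \<and> z = xs ! 1"
proof -
  obtain j where j: "j < length xs" "z = xs ! j" using z(2) by (auto simp: in_set_conv_nth)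
  have hd: "hd xs = xs ! 0" using path by (simp add: path_from_def hd_conv_nth)
  have "j \<noteq> 0" using simple_graph_no_loop[OF E(1) z(1)] j hd by metis
  have "\<not> 2 \<le> j"
  proof
    assume "2 \<le> j"
    have "is_cycle E (take (Suc j) xs)"
      unfolding is_cycle_def
    proof (intro conjI allI impI)
      show "3 \<le> length (take (Suc j) xs)" using j \<open>2 \<le> j\<close> by simp
      show "distinct (take (Suc j) xs)" using path by (simp add: path_from_def)
      fix i assume "i < length (take (Suc j) xs)"
      then have "i \<le> j" using j by simp
      show "{take (Suc j) xs ! i, take (Suc j) xs ! (Suc i mod length (take (Suc j) xs))} \<in> E"
      proof (cases "i = j")
        case True
        then show ?thesis using z(1) j hd by (simp add: insert_commute)
      next
        case False
        then show ?thesis using \<open>i \<le> j\<close> j path by (simp add: path_from_def)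
      qed
    qed
    with E(2) show False by blast
  qed
  then have "j = 1" using \<open>j \<noteq> 0\<close> by simp
  then show ?thesis using j by simp
qed

lemma simple_graph_edge_subset: "simple_graph V E \<Longrightarrow> {u, v} \<in> E \<Longrightarrow> v \<in> V"
  by (auto simp: simple_graph_def)

text \<open>On a longest path from \<open>\<rho>\<close>, all neighbours of the penultimate vertex \<open>v\<close> except its predecessor
  \<open>p\<close> are leaves.\<close>

lemma tree_has_leaf_star:
  assumes tree: "is_tree V E" and "\<rho> \<in> V" "V \<noteq> {\<rho>}"
  obtains v S where "v \<in> V - S" "S \<noteq> {}" "S \<subseteq> V - {\<rho>}" "\<And>s. s \<in> S \<Longrightarrow> {w. {s, w} \<in> E} = {v}"
    "if v = \<rho> then {w. {v, w} \<in> E} = S else (\<exists>p. p \<notin> S \<and> {w. {v, w} \<in> E} = insert p S)"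
proof -
  have sg: "simple_graph V E" and "finite V" and conn: "connected_graph V E"
    and acyc: "\<nexists>xs. is_cycle E xs"
    using tree by (auto simp: is_tree_def simple_graph_def)
  have sym: "{a, b} \<in> E \<Longrightarrow> {b, a} \<in> E" for a b by (simp add: insert_commute)
  obtain u where "u \<in> V" "u \<noteq> \<rho>" using assms by blast
  then have "(\<rho>, u) \<in> {(x, y). {x, y} \<in> E}\<^sup>*"
    using conn \<open>\<rho> \<in> V\<close> by (simp add: connected_graph_def)
  then obtain w where w: "{\<rho>, w} \<in> E" using \<open>u \<noteq> \<rho>\<close> by (auto elim: converse_rtranclE)
  have path2: "path_from V E \<rho> [w, \<rho>]"
    using sym[OF w] simple_graph_no_loop[OF sg w] simple_graph_edge_subset[OF sg w] \<open>\<rho> \<in> V\<close>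
    by (auto simp: path_from_def)
  have "length xs < card V + 1" if "path_from V E \<rho> xs" for xs
    using that \<open>finite V\<close> by (metis Suc_eq_plus1 card_mono distinct_card le_imp_less_Suc path_from_def)
  then obtain xs where xs: "path_from V E \<rho> xs"
    and longest: "\<And>ys. path_from V E \<rho> ys \<Longrightarrow> length ys \<le> length xs"
    using ex_has_greatest_nat[of "path_from V E \<rho>" "[w, \<rho>]" length "card V + 1"] path2 by blast
  have "2 \<le> length xs" using longest[OF path2] by simp
  then obtain x v rest where xs_eq: "xs = x # v # rest"
    by (metis Suc_le_length_iff numeral_2_eq_2)
  have path_v: "path_from V E \<rho> (v # rest)" using xs unfolding xs_eq by (rule path_from_tl)
  then have v: "v \<in> V" "distinct (v # rest)" "last (v # rest) = \<rho>"
    by (auto simp: path_from_def)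
  define S where "S = {w. {v, w} \<in> E} - set (v # rest)"
  have leaf: "{w. {s, w} \<in> E} = {v}" if "s \<in> S" for s
  proof -
    have s: "{v, s} \<in> E" "s \<notin> set (v # rest)" using that by (auto simp: S_def)
    \<comment> \<open>Every \<open>s\<close> in \<open>S\<close> can take the place of
      \<open>x\<close> at the end of a path of the same maximal length, so it has no neighbour off
      this path, and by acyclicity none on it except \<open>v\<close>.\<close>
    then have path_s: "path_from V E \<rho> (s # v # rest)"
      using sym simple_graph_edge_subset[OF sg] by (intro path_from_Cons[OF path_v]) auto
    have "w = v" if w: "{s, w} \<in> E" for w
    proof (cases "w \<in> set (s # v # rest)")
      case True
      then show ?thesis using path_from_no_chord[OF sg acyc path_s] w by simp
    next
      case False
      then have "path_from V E \<rho> (w # s # v # rest)"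
        using sym[OF w] simple_graph_edge_subset[OF sg w] by (intro path_from_Cons[OF path_s]) auto
      then show ?thesis using longest[of "w # s # v # rest"] xs_eq by simp
    qed
    then show ?thesis using sym[OF s(1)] by blast
  qed
  have "x \<in> S"
    using xs sym[OF path_from_head_edge[of V E \<rho> x v rest]] unfolding xs_eq
    by (auto simp: S_def path_from_def)
  then have "S \<noteq> {}" by blast
  have "\<rho> \<in> set (v # rest)" using v(3) by (metis last_in_set list.distinct(1))
  then have "S \<subseteq> V - {\<rho>}" using simple_graph_edge_subset[OF sg] by (auto simp: S_def)
  have nb: "if v = \<rho> then {w. {v, w} \<in> E} = S
    else (\<exists>p. p \<notin> S \<and> {w. {v, w} \<in> E} = insert p S)"
  proof (cases rest)
    case Nil
    then have "{w. {v, w} \<in> E} = S" using simple_graph_no_loop[OF sg] by (auto simp: S_def)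
    then show ?thesis using v(3) Nil by simp
  next
    case (Cons p ps)
    have "v \<noteq> \<rho>" using v(2,3) Cons by (metis distinct.simps(2) last.simps last_in_set list.distinct(1))
    have "{v, p} \<in> E" using path_v unfolding Cons by (rule path_from_head_edge)
    moreover have "w = p" if "{v, w} \<in> E" "w \<in> set (v # rest)" for w
      using path_from_no_chord[OF sg acyc path_v] that Cons by simp
    moreover have "p \<notin> S" by (simp add: S_def Cons)
    ultimately have "p \<notin> S \<and> {w. {v, w} \<in> E} = insert p S"
      unfolding S_def by blast
    then show ?thesis using \<open>v \<noteq> \<rho>\<close> by auto
  qed
  have "v \<in> V - S" using v(1) by (simp add: S_def)
  then show thesis
    using \<open>S \<noteq> {}\<close> \<open>S \<subseteq> V - {\<rho>}\<close> leaf nb by (rule that)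
qed

section \<open>Cutting off leaves\<close>

lemma is_tree_remove_leaves:
  assumes tree: "is_tree V E" and "v \<in> V - S" and leaf: "\<And>s. s \<in> S \<Longrightarrow> {w. {s, w} \<in> E} = {v}"
  shows "is_tree (V - S) {e \<in> E. e \<inter> S = {}}"
proof -
  let ?E = "{e \<in> E. e \<inter> S = {}}"
  let ?R = "{(x, y). {x, y} \<in> E}" and ?R' = "{(x, y). {x, y} \<in> ?E}"
  \<comment> \<open>Walks are followed under the retraction sending all of \<open>S\<close> to
    \<open>v\<close>; a step into or out of a removed leaf becomes stationary.\<close>
  have conn: "(a, if b \<in> S then v else b) \<in> ?R'\<^sup>*" if "(a, b) \<in> ?R\<^sup>*" "a \<notin> S" for a b
    using that(1)
  proof (induction rule: rtrancl_induct)
    case base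
    then show ?case using \<open>a \<notin> S\<close> by simp
  next
    case (step b c)
    have bc: "{b, c} \<in> E" "{c, b} \<in> E" using step(2) by (auto simp: insert_commute)
    have "c = v" if "b \<in> S" using leaf[OF that] bc by blast
    moreover have "b = v" if "c \<in> S" using leaf[OF that] bc by blast
    moreover have "(b, c) \<in> ?R'" if "b \<notin> S" "c \<notin> S" using that bc by auto
    ultimately show ?case
      using step.IH \<open>v \<in> V - S\<close> by (auto intro: rtrancl_into_rtrancl split: if_splits)
  qed
  have "simple_graph (V - S) ?E"
    using tree by (auto simp: is_tree_def simple_graph_def)
  moreover have "connected_graph (V - S) ?E"
    unfolding connected_graph_def
  proof (intro conjI ballI)
    show "V - S \<noteq> {}" using \<open>v \<in> V - S\<close> by blast
    fix a b assume "a \<in> V - S" "b \<in> V - S"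
    then show "(a, b) \<in> ?R'\<^sup>*"
      using conn[of a b] tree by (simp add: is_tree_def connected_graph_def)
  qed
  moreover have "\<nexists>xs. is_cycle ?E xs"
    using tree by (auto simp: is_tree_def is_cycle_def)
  ultimately show ?thesis by (simp add: is_tree_def)
qed

text \<open>The stringiness with the raised factor at a prescribed vertex. Unlike a sorted degree
  sequence, it can be traced through the removal of leaves.\<close>

definition rooted_weight :: "'v set \<Rightarrow> 'v set set \<Rightarrow> 'v \<Rightarrow> nat" where
  "rooted_weight V E \<rho> = (vdegree E \<rho> + 1) * (\<Prod>v\<in>V - {\<rho>}. vdegree E v)"

text \<open>The removed leaves contribute factors 1, and among the remaining vertices only the
  degree of \<open>v\<close> changes. Away from the root it drops from \<open>card S + 1\<close> to
  1; at the root it drops from \<open>card S\<close> to 0, and the raised factor again from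
  \<open>card S + 1\<close> to 1.\<close>

lemma rooted_weight_remove_leaves:
  assumes sg: "simple_graph V E" and "v \<in> V - S" "S \<subseteq> V - {\<rho>}" "\<rho> \<in> V"
    and leaf: "\<And>s. s \<in> S \<Longrightarrow> {w. {s, w} \<in> E} = {v}"
    and nb: "if v = \<rho> then {w. {v, w} \<in> E} = S else (\<exists>p. p \<notin> S \<and> {w. {v, w} \<in> E} = insert p S)"
  shows "rooted_weight V E \<rho> = (card S + 1) * rooted_weight (V - S) {e \<in> E. e \<inter> S = {}} \<rho>"
proof -
  let ?E = "{e \<in> E. e \<inter> S = {}}"
  have fin: "finite V" "finite S" using sg assms(3) by (auto simp: simple_graph_def finite_subset)
  have sg': "simple_graph (V - S) ?E" using sg by (auto simp: simple_graph_def)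
  have nb': "{w. {a, w} \<in> ?E} = {w. {a, w} \<in> E} - S" if "a \<notin> S" for a using that by auto
  have leaf_deg: "vdegree E s = 1" if "s \<in> S" for s
    using leaf[OF that] by (simp add: vdegree_eq_card_neighbours[OF sg])
  have deg_other: "vdegree ?E a = vdegree E a" if "a \<notin> S" "a \<noteq> v" for a
  proof -
    have "s \<notin> {w. {a, w} \<in> E}" if "s \<in> S" for s
    proof
      assume "s \<in> {w. {a, w} \<in> E}"
      then have "a \<in> {w. {s, w} \<in> E}" by (simp add: insert_commute)
      then show False using leaf[OF that] \<open>a \<noteq> v\<close> by simp
    qed
    then have "{w. {a, w} \<in> ?E} = {w. {a, w} \<in> E}" using nb'[OF \<open>a \<notin> S\<close>] by blast
    then show ?thesis
      by (simp add: vdegree_eq_card_neighbours[OF sg] vdegree_eq_card_neighbours[OF sg'])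
  qed
  have deg_v: "vdegree E v = (if v = \<rho> then card S else card S + 1)"
    "vdegree ?E v = (if v = \<rho> then 0 else 1)"
  proof -
    have "v \<notin> S" using assms(2) by simp
    show "vdegree E v = (if v = \<rho> then card S else card S + 1)"
      using nb fin by (auto simp: vdegree_eq_card_neighbours[OF sg] split: if_splits)
    show "vdegree ?E v = (if v = \<rho> then 0 else 1)"
      unfolding vdegree_eq_card_neighbours[OF sg'] nb'[OF \<open>v \<notin> S\<close>]
      using nb by (auto simp: insert_Diff_if split: if_splits)
  qed
  have "V - {\<rho>} = (V - S - {\<rho>}) \<union> S" using assms(3) by auto
  then have "(\<Prod>w\<in>V - {\<rho>}. vdegree E w) = (\<Prod>w\<in>V - S - {\<rho>}. vdegree E w) * (\<Prod>w\<in>S. vdegree E w)"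
    using fin by (metis Diff_Diff_Int Diff_disjoint Int_commute Int_Diff finite_Diff prod.union_disjoint)
  then have prod: "(\<Prod>w\<in>V - {\<rho>}. vdegree E w) = (\<Prod>w\<in>V - S - {\<rho>}. vdegree E w)"
    using leaf_deg by simp
  show ?thesis
  proof (cases "v = \<rho>")
    case True
    have "(\<Prod>w\<in>V - S - {\<rho>}. vdegree E w) = (\<Prod>w\<in>V - S - {\<rho>}. vdegree ?E w)"
      using True deg_other by (intro prod.cong) auto
    then show ?thesis using prod deg_v True by (simp add: rooted_weight_def)
  next
    case False
    have "\<rho> \<notin> S" using assms(3) by blast
    have v: "v \<in> V - S - {\<rho>}" using False assms(2) by blast
    have "(\<Prod>w\<in>V - S - {\<rho>} - {v}. vdegree E w) = (\<Prod>w\<in>V - S - {\<rho>} - {v}. vdegree ?E w)"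
      using deg_other by (intro prod.cong) auto
    then have "(\<Prod>w\<in>V - S - {\<rho>}. vdegree E w) = (card S + 1) * (\<Prod>w\<in>V - S - {\<rho>}. vdegree ?E w)"
      using fin deg_v False by (simp add: prod.remove[OF _ v])
    then show ?thesis
      using prod deg_other[OF \<open>\<rho> \<notin> S\<close>] False by (simp add: rooted_weight_def algebra_simps)
  qed
qed

text \<open>Leaf star, smaller tree and weight identity are packed into one rule, which hides the
  distinction between \<open>v = \<rho>\<close> and \<open>v \<noteq> \<rho>\<close> from both
  inductions that use it.\<close>

lemma tree_leaf_star_induct [consumes 2, case_names singleton star]:
  assumes "is_tree V E" "\<rho> \<in> V"
    and single: "\<And>E. is_tree {\<rho>} E \<Longrightarrow> P {\<rho>} E"
    and star: "\<And>V E v S. is_tree V E \<Longrightarrow> v \<in> V - S \<Longrightarrow> S \<noteq> {} \<Longrightarrow> S \<subseteq> V \<Longrightarrow>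
      (\<And>s. s \<in> S \<Longrightarrow> {w. {s, w} \<in> E} = {v}) \<Longrightarrow>
      rooted_weight V E \<rho> = (card S + 1) * rooted_weight (V - S) {e \<in> E. e \<inter> S = {}} \<rho> \<Longrightarrow>
      P (V - S) {e \<in> E. e \<inter> S = {}} \<Longrightarrow> P V E"
  shows "P V E"
proof -
  have "finite V" using assms(1) by (simp add: is_tree_def simple_graph_def)
  then show ?thesis using assms(1,2)
  proof (induction V arbitrary: E rule: finite_psubset_induct)
    case (psubset V)
    show ?case
    proof (cases "V = {\<rho>}")
      case True
      then show ?thesis using single psubset.prems by simp
    next
      case False
      obtain v S where vS: "v \<in> V - S" "S \<noteq> {}" "S \<subseteq> V - {\<rho>}" "\<And>s. s \<in> S \<Longrightarrow> {w. {s, w} \<in> E} = {v}"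
        "if v = \<rho> then {w. {v, w} \<in> E} = S else (\<exists>p. p \<notin> S \<and> {w. {v, w} \<in> E} = insert p S)"
        by (rule tree_has_leaf_star[OF psubset.prems False]) (rule that)
      have "simple_graph V E" using psubset.prems(1) by (simp add: is_tree_def)
      note weight = rooted_weight_remove_leaves[OF this vS(1,3) psubset.prems(2) vS(4,5)]
      have "V - S \<subset> V" "\<rho> \<in> V - S" "S \<subseteq> V" using vS(2,3) psubset.prems(2) by auto
      have IH: "P (V - S) {e \<in> E. e \<inter> S = {}}"
        by (rule psubset.IH[OF \<open>V - S \<subset> V\<close> is_tree_remove_leaves[OF psubset.prems(1) vS(1,4)]
              \<open>\<rho> \<in> V - S\<close>])
      show ?thesis
        by (rule star[OF psubset.prems(1) vS(1,2) \<open>S \<subseteq> V\<close> _ weight IH]) (rule vS(4))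
    qed
  qed
qed

lemma is_tree_singleton_no_edges: "is_tree {\<rho>} E \<Longrightarrow> E = {}"
  by (auto simp: is_tree_def simple_graph_def subset_singleton_iff)

text \<open>With \<open>w \<ge> 1\<close> the weight of the smaller tree,
  \<open>(s + 1) * w \<ge> w + s\<close>, while the number of vertices grows only by
  \<open>s\<close>.\<close>

lemma card_le_rooted_weight:
  assumes "is_tree V E" "\<rho> \<in> V"
  shows "card V \<le> rooted_weight V E \<rho>"
  using assms
proof (induction rule: tree_leaf_star_induct)
  case (singleton E)
  then show ?case by (simp add: rooted_weight_def)
next
  case (star V E v S)
  let ?w = "rooted_weight (V - S) {e \<in> E. e \<inter> S = {}} \<rho>"
  have "finite V" using star.hyps(1) by (simp add: is_tree_def simple_graph_def)
  then have "card V = card S + card (V - S)"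
    using star.hyps(4) by (metis card_Diff_subset card_mono finite_subset le_add_diff_inverse)
  moreover have "1 \<le> card (V - S)"
    using \<open>finite V\<close> star.hyps(2) by (metis One_nat_def Suc_leI card_gt_0_iff empty_iff finite_Diff)
  then have "card S * 1 \<le> card S * ?w" using star.IH by (intro mult_le_mono2) simp
  ultimately show ?case
    using star.IH unfolding star.hyps(6) distrib_right by linarith
qed

section \<open>Colour-preserving embeddings\<close>

definition colored_embedding :: "'t set \<Rightarrow> 't set set \<Rightarrow> ('t set \<Rightarrow> 'c) \<Rightarrow> 'v set set \<Rightarrow>
    ('v set \<Rightarrow> 'c) \<Rightarrow> 'v set \<Rightarrow> ('t \<Rightarrow> 'v) \<Rightarrow> bool" where
  "colored_embedding VT ET colT E col U \<phi> \<longleftrightarrow> inj_on \<phi> VT \<and> \<phi> ` VT \<subseteq> U \<and>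
     (\<forall>e\<in>ET. \<phi> ` e \<in> E \<and> col (\<phi> ` e) = colT e)"

text \<open>The tree without the leaves \<open>S\<close> is embedded into the centres of a large family of disjoint stars;
  then only the star around the image of \<open>v\<close> is attached.\<close>

lemma tree_embedding_exists:
  fixes E :: "'v::finite set set" and col :: "'v set \<Rightarrow> 'c" and D :: "'c set"
    and VT :: "'t set" and L :: real
  assumes tree: "is_tree VT ET" "\<rho> \<in> VT" and "0 \<le> L"
    and star_ex: "\<And>(S :: 't set) k W. \<lbrakk>finite S; S \<noteq> {}; k ` S \<subseteq> D; real (card S) * L < real (card W)\<rbrakk>
      \<Longrightarrow> \<exists>u f. star_in E col S k W u f"
    and "\<forall>e\<in>ET. colT e \<in> D"
    and "(real (rooted_weight VT ET \<rho>) - 1) * L < real (card U)"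
  shows "\<exists>\<phi>. colored_embedding VT ET colT E col U \<phi>"
  using tree assms(5,6)
proof (induction arbitrary: U rule: tree_leaf_star_induct)
  case (singleton ET)
  have "ET = {}" using is_tree_singleton_no_edges[OF singleton.hyps] .
  \<comment> \<open>An isolated root has weight 1, so the threshold is 0.\<close>
  then have "0 < card U" using singleton.prems by (simp add: rooted_weight_def vdegree_def)
  then obtain u where "u \<in> U" by (auto simp: card_gt_0_iff)
  then show ?case using \<open>ET = {}\<close> by (intro exI[of _ "\<lambda>_. u"]) (simp add: colored_embedding_def)
next
  case (star VT ET v S)
  define ET' where "ET' = {e \<in> ET. e \<inter> S = {}}"
  define w where "w = rooted_weight (VT - S) ET' \<rho>"
  define k where "k s = colT {v, s}" for s
  \<comment> \<open>Stars are reduced to their vertex sets to suit the greedy selection; a centre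
    and a leaf map are chosen again for each selected set.\<close>
  define F where "F = {insert u (f ` S) |u f. star_in E col S k UNIV u f}"
  have sg: "simple_graph VT ET" and fin: "finite VT" "finite S"
    using star.hyps(1,4) by (auto simp: is_tree_def simple_graph_def finite_subset)
  have edge: "{v, s} \<in> ET" if "s \<in> S" for s
    using star.hyps(5)[OF that] by (auto simp: insert_commute)
  have kD: "k ` S \<subseteq> D" using edge star.prems(1) by (auto simp: k_def)
  have cardF: "card A = card S + 1" if "A \<in> F" for A
    using that fin by (auto simp: F_def star_in_def card_image)
  have exF: "\<exists>A\<in>F. A \<subseteq> W" if W: "real (card S) * L < real (card W)" for W
  proof -
    obtain u f where "star_in E col S k W u f"
      using star_ex[OF fin(2) star.hyps(3) kD W] by blast
    then have "star_in E col S k UNIV u f" "insert u (f ` S) \<subseteq> W" by (auto simp: star_in_def)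
    then show ?thesis by (auto simp: F_def)
  qed
  have "0 < card S + 1" by simp
  from disjoint_family_greedy[of U F "card S + 1" "real (card S) * L", OF finite cardF this exF]
  obtain \<C> where C: "\<C> \<subseteq> F" "\<And>A. A \<in> \<C> \<Longrightarrow> A \<subseteq> U" "pairwise disjnt \<C>"
    "real (card U) - real (card S) * L \<le> real (card S + 1) * real (card \<C>)"
    by blast
  have "\<forall>A\<in>\<C>. \<exists>u f. A = insert u (f ` S) \<and> star_in E col S k UNIV u f"
    using C(1) by (auto simp: F_def)
  then obtain c f where cf: "\<And>A. A \<in> \<C> \<Longrightarrow> A = insert (c A) (f A ` S)"
    "\<And>A. A \<in> \<C> \<Longrightarrow> star_in E col S k UNIV (c A) (f A)"
    by metis
  have mem: "c A \<in> A" if "A \<in> \<C>" for A using cf(1)[OF that] by blast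
  have uniq: "A = B" if "A \<in> \<C>" "B \<in> \<C>" "x \<in> A" "x \<in> B" for A B x
    using C(3) that by (auto simp: pairwise_def disjnt_def)
  have inj: "inj_on c \<C>" using uniq mem by (metis inj_onI)
  \<comment> \<open>The count of stars is just enough for the induction hypothesis on the set of
    centres.\<close>
  have "(real (card S + 1)) * ((real w - 1) * L) = (real (rooted_weight VT ET \<rho>) - 1) * L - card S * L"
    by (simp add: star.hyps(6) w_def ET'_def algebra_simps)
  also have "\<dots> < real (card S + 1) * real (card \<C>)" using star.prems(2) C(4) by linarith
  finally have "(real w - 1) * L < real (card (c ` \<C>))"
    by (simp only: card_image[OF inj] mult_less_cancel_left_pos of_nat_0_less_iff \<open>0 < card S + 1\<close>)
  then obtain \<phi> where \<phi>: "colored_embedding (VT - S) ET' colT E col (c ` \<C>) \<phi>"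
    using star.IH[of "c ` \<C>"] star.prems(1) by (auto simp: w_def ET'_def)
  then have "\<phi> v \<in> c ` \<C>" using star.hyps(2) by (auto simp: colored_embedding_def)
  then obtain A where A: "A \<in> \<C>" "\<phi> v = c A" by blast
  note fA = cf(2)[OF A(1), unfolded star_in_def]
  define \<psi> where "\<psi> x = (if x \<in> S then f A x else \<phi> x)" for x
  have "v \<notin> S" using star.hyps(2) by blast
  \<comment> \<open>All images under \<open>\<phi>\<close> are centres, and a star of the disjoint
    family contains no centre but its own. Hence the leaves of the star at \<open>\<phi> v\<close>
    are still free.\<close>
  have meet: "\<phi> x = \<phi> v" if "x \<in> VT - S" "\<phi> x \<in> A" for x
  proof -
    have "\<phi> x \<in> c ` \<C>" using \<phi> that(1) by (auto simp: colored_embedding_def)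
    then obtain B where B: "B \<in> \<C>" "\<phi> x = c B" by blast
    then have "B = A" using uniq[OF B(1) A(1)] mem[OF B(1)] that(2) by simp
    then show ?thesis using A(2) B(2) by simp
  qed
  have fA_A: "f A s \<in> A" "f A s \<noteq> \<phi> v" if "s \<in> S" for s
    using cf(1)[OF A(1)] fA A(2) that by (blast, metis imageI)
  have "inj_on \<psi> VT"
  proof -
    have "inj_on \<psi> ((VT - S) \<union> S)"
      unfolding inj_on_Un
    proof (intro conjI)
      show "inj_on \<psi> (VT - S)"
        using \<phi> by (auto simp: colored_embedding_def \<psi>_def inj_on_def)
      show "inj_on \<psi> S" using fA by (auto simp: \<psi>_def inj_on_def)
      show "\<psi> ` (VT - S - S) \<inter> \<psi> ` (S - (VT - S)) = {}"
        using meet fA_A by (fastforce simp: \<psi>_def)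
    qed
    then show ?thesis using star.hyps(4) by (simp add: Un_absorb2)
  qed
  moreover have "\<psi> ` VT \<subseteq> U"
  proof
    fix y assume "y \<in> \<psi> ` VT"
    then obtain x where x: "x \<in> VT" "y = \<psi> x" by blast
    show "y \<in> U"
    proof (cases "x \<in> S")
      case True
      then show ?thesis using fA_A[OF True] C(2)[OF A(1)] x by (auto simp: \<psi>_def)
    next
      case False
      then have "\<phi> x \<in> c ` \<C>" using \<phi> x(1) by (auto simp: colored_embedding_def)
      then obtain B where "B \<in> \<C>" "\<phi> x = c B" by blast
      then show ?thesis using mem[of B] C(2)[of B] False x(2) by (auto simp: \<psi>_def)
    qed
  qed
  moreover have "\<psi> ` e \<in> E \<and> col (\<psi> ` e) = colT e" if "e \<in> ET" for e
  proof (cases "e \<inter> S = {}")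
    case True
    then have "\<psi> ` e = \<phi> ` e" by (intro image_cong) (auto simp: \<psi>_def)
    then show ?thesis using \<phi> True that by (auto simp: colored_embedding_def ET'_def)
  next
    case False
    then obtain s where s: "s \<in> S" "s \<in> e" by blast
    have "card e = 2" using sg that by (simp add: simple_graph_def)
    then obtain t where t: "e = {s, t}" using s(2) by (auto simp: card_2_iff)
    then have "t = v" using star.hyps(5)[OF s(1)] that by blast
    then have "e = {v, s}" using t by blast
    then have "\<psi> ` e = {c A, f A s}" using \<open>v \<notin> S\<close> s(1) A(2) by (simp add: \<psi>_def)
    then show ?thesis using fA s(1) \<open>e = {v, s}\<close> by (simp add: k_def)
  qed
  ultimately show ?case unfolding colored_embedding_def by blast
qed

section \<open>Stringiness and the number of disjoint copies\<close>

lemma stringiness_eq_rooted_weight: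
  assumes "finite V" "V \<noteq> {}"
  obtains \<rho> where "\<rho> \<in> V" "stringiness V E = rooted_weight V E \<rho>"
proof -
  define ds where "ds = degree_sequence V E"
  have mset: "mset ds = image_mset (vdegree E) (mset_set V)"
    by (simp add: ds_def degree_sequence_def)
  then have "ds \<noteq> []" using assms by (auto simp: mset_set_empty_iff)
  then obtain d ds' where ds: "ds = d # ds'" by (cases ds) auto
  have "d \<in># image_mset (vdegree E) (mset_set V)" using mset ds by (metis list.set_intros(1) set_mset_mset)
  then obtain \<rho> where \<rho>: "\<rho> \<in> V" "d = vdegree E \<rho>" using assms(1) by auto
  \<comment> \<open>Deleting one vertex that attains the head of the sequence leaves the tail as a
    multiset, which suffices for the product.\<close>
  have "mset_set V = add_mset \<rho> (mset_set (V - {\<rho>}))"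
    using assms(1) \<rho>(1) by (simp add: mset_set.remove)
  then have "mset ds' = image_mset (vdegree E) (mset_set (V - {\<rho>}))"
    using mset \<rho>(2) by (simp add: ds)
  then have "prod_list ds' = (\<Prod>v\<in>V - {\<rho>}. vdegree E v)"
    by (metis prod_mset_prod_list prod_unfold_prod_mset)
  then have "stringiness V E = rooted_weight V E \<rho>"
    using \<rho>(2) by (simp add: stringiness_def Let_def rooted_weight_def ds flip: ds_def)
  then show thesis using that \<rho>(1) by blast
qed

lemma disjoint_copies_greedy:
  fixes E :: "'v::finite set set" and VT :: "'t set" and b :: real
  assumes "finite VT" "VT \<noteq> {}"
    and ex: "\<And>W. W \<subseteq> U \<Longrightarrow> b < real (card W) \<Longrightarrow> \<exists>\<phi>. colored_embedding VT ET colT E col W \<phi>"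
  shows "\<exists>\<C>. disjoint_copies VT ET colT E col U \<C> \<and>
    real (card U) - b \<le> real (card VT) * real (card \<C>)"
proof -
  define F where "F = {\<phi> ` VT |\<phi>. colored_embedding VT ET colT E col UNIV \<phi>}"
  have cardF: "card A = card VT" if "A \<in> F" for A
    using that by (auto simp: F_def colored_embedding_def card_image)
  have exF: "\<exists>A\<in>F. A \<subseteq> W" if W: "W \<subseteq> U" "b < real (card W)" for W
  proof -
    obtain \<phi> where "colored_embedding VT ET colT E col W \<phi>" using ex[OF W] by blast
    then have "colored_embedding VT ET colT E col UNIV \<phi>" "\<phi> ` VT \<subseteq> W"
      by (auto simp: colored_embedding_def)
    then show ?thesis by (auto simp: F_def)
  qed
  have "0 < card VT" using assms(1,2) by (simp add: card_gt_0_iff)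
  from disjoint_family_greedy[of U F "card VT" b, OF finite cardF this exF]
  obtain \<A> where A: "\<A> \<subseteq> F" "finite \<A>" "\<And>A. A \<in> \<A> \<Longrightarrow> A \<subseteq> U" "pairwise disjnt \<A>"
    "real (card U) - b \<le> real (card VT) * real (card \<A>)"
    by blast
  have "\<forall>A\<in>\<A>. \<exists>\<phi>. A = \<phi> ` VT \<and> colored_embedding VT ET colT E col UNIV \<phi>"
    using A(1) by (auto simp: F_def)
  then obtain \<phi> where \<phi>: "\<And>A. A \<in> \<A> \<Longrightarrow> \<phi> A ` VT = A"
    "\<And>A. A \<in> \<A> \<Longrightarrow> colored_embedding VT ET colT E col UNIV (\<phi> A)"
    by metis
  \<comment> \<open>Keeping the vertex set as first component makes \<open>copy\<close> injective,
    so the number of members is preserved.\<close>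
  define copy where "copy A = (A, (\<lambda>e. \<phi> A ` e) ` ET)" for A
  have "is_copy VT ET colT E col U (copy A)" if "A \<in> \<A>" for A
    using \<phi>(1)[OF that] \<phi>(2)[OF that] A(3)[OF that]
    by (auto simp: is_copy_def copy_def colored_embedding_def bij_betw_def intro!: exI[of _ "\<phi> A"])
  moreover have "pairwise (\<lambda>C C'. fst C \<inter> fst C' = {}) (copy ` \<A>)"
    using A(4) by (auto simp: pairwise_def disjnt_def copy_def)
  ultimately have "disjoint_copies VT ET colT E col U (copy ` \<A>)"
    using A(2) by (auto simp: disjoint_copies_def)
  moreover have "card (copy ` \<A>) = card \<A>"
    by (intro card_image) (auto simp: inj_on_def copy_def)
  ultimately show ?thesis using A(5) by metis
qed

theorem theorem1p7:
  fixes E :: "'v::finite set set" and col :: "'v set \<Rightarrow> 'c" and D :: "'c set"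
    and VT :: "'t set" and ET :: "'t set set" and colT :: "'t set \<Rightarrow> 'c"
    and n d :: nat and lam r :: real and U :: "'v set"
  assumes "0 < d" and "0 \<le> lam"
    and "ndl_colored_graph n d lam D E col"
    and "is_tree VT ET" and "\<forall>e\<in>ET. colT e \<in> D"
    and "real (card U) = r * (lam * real n / real d)"
  shows "\<exists>\<C>. disjoint_copies VT ET colT E col U \<C> \<and>
    real (card \<C>) \<ge> real (card U) / real (stringiness VT ET) - lam * real n / real d"
proof -
  define L where "L = lam * real n / real d"
  have "0 \<le> L" using assms(2) by (simp add: L_def)
  have VT: "finite VT" "VT \<noteq> {}"
    using assms(4) by (auto simp: is_tree_def simple_graph_def connected_graph_def)
  then obtain \<rho> where \<rho>: "\<rho> \<in> VT" "stringiness VT ET = rooted_weight VT ET \<rho>"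
    by (rule stringiness_eq_rooted_weight)
  define w where "w = real (stringiness VT ET)"
  have "\<exists>\<phi>. colored_embedding VT ET colT E col W \<phi>" if "(w - 1) * L < real (card W)" for W
    by (rule tree_embedding_exists[OF assms(4) \<rho>(1) \<open>0 \<le> L\<close> star_exists[OF assms(3,1)] assms(5)])
      (use that in \<open>simp_all add: w_def \<rho>(2) L_def\<close>)
  then obtain \<C> where C: "disjoint_copies VT ET colT E col U \<C>"
    "real (card U) - (w - 1) * L \<le> real (card VT) * real (card \<C>)"
    using disjoint_copies_greedy[OF VT, of U "(w - 1) * L"] by metis
  have "real (card VT) \<le> w"
    using card_le_rooted_weight[OF assms(4) \<rho>(1)] by (simp add: w_def \<rho>(2))
  moreover have "0 < card VT" using VT by (simp add: card_gt_0_iff)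
  ultimately have "0 < w" by linarith
  \<comment> \<open>Replacing the size of a copy by the larger \<open>w\<close> produces the
    division by the stringiness; enlarging \<open>w - 1\<close> to \<open>w\<close> then makes the
    subtracted term exactly \<open>L\<close>.\<close>
  have "real (card VT) * real (card \<C>) \<le> w * real (card \<C>)"
    using \<open>real (card VT) \<le> w\<close> by (rule mult_right_mono) simp
  moreover have "(w - 1) * L \<le> w * L" using \<open>0 \<le> L\<close> by (intro mult_right_mono) auto
  ultimately have "real (card U) \<le> (real (card \<C>) + L) * w"
    using C(2) by (simp add: algebra_simps)
  then have "real (card U) / w - L \<le> real (card \<C>)"
    using \<open>0 < w\<close> by (simp add: pos_divide_le_eq diff_le_eq)
  then show ?thesis using C(1) by (auto simp: w_def L_def)
qed

end
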